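(* Let $z_1^0,\dots,z_n^0\in\mathbb{R}^d$ and $z_1^\star,\dots,z_n^\star\in\mathbb{R}^d$ be the blocks of the initialization $\boldsymbol{z}^0$ and of the fixed point $\boldsymbol{z}^\star$ of Prox-DFinito. The optimal cyclic order is the reverse (i.e. decreasing) order of $\{\|z_i^0-z_i^\star\|^2\}_{i=1}^n$: if $\pi^\star$ is a permutation of $[n]$ with $$\|z_{\pi^\star(1)}^0-z_{\pi^\star(1)}^\star\|^2\ge\|z_{\pi^\star(2)}^0-z_{\pi^\star(2)}^\star\|^2\ge\cdots\ge\|z_{\pi^\star(n)}^0-z_{\pi^\star(n)}^\star\|^2,$$ then $\pi^\star\in\arg\min_\pi\|\boldsymbol{z}^0-\boldsymbol{z}^\star\|_\pi^2$, the minimum being over all permutations $\pi$ of $[n]$.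
   Context: $[n]=\{1,\dots,n\}$. For a permutation $\pi$ of $[n]$ and $\boldsymbol{z}=\mathrm{col}\{z_1,\dots,z_n\}\in\mathbb{R}^{nd}$ (stacked vector), the order-specific norm is $\|\boldsymbol{z}\|_\pi^2=\sum_{i=1}^n\frac{i}{n}\|z_{\pi(i)}\|^2$. An optimal cyclic sampling order of Prox-DFinito is by definition $\pi^\star:=\arg\min_\pi\|\boldsymbol{z}^0-\boldsymbol{z}^\star\|_\pi^2$. Here $\boldsymbol{z}^0$ is the initialization of the algorithm (arbitrary) and $z_i^\star=x^\star-\alpha\nabla f_i(x^\star)$, where $\alpha>0$ is the step-size and $x^\star$ is a minimizer of $\frac1n\sum_i f_i+r$ with $f_i$ differentiable convex and $r$ convex; only the vectors $\boldsymbol{z}^0,\boldsymbol{z}^\star$ matter for the claim. *)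

theory Defs
  imports "HOL-Analysis.Analysis"
begin

text \<open>
  Stacked vectors in \<open>\<real>\<^sup>n\<^sup>d\<close> are represented by their blocks, as functions
  \<open>z :: nat \<Rightarrow> real ^ 'd\<close> of which only the values on \<open>{1..n}\<close> are relevant.
\<close>

definition order_norm :: "nat \<Rightarrow> (nat \<Rightarrow> nat) \<Rightarrow> (nat \<Rightarrow> real ^ 'd) \<Rightarrow> real" where
  "order_norm n \<pi> z = sqrt (\<Sum>i\<in>{1..n}. real i / real n * (norm (z (\<pi> i)))\<^sup>2)"

lemma order_norm_power2:
  "(order_norm n \<pi> z)\<^sup>2 = (\<Sum>i\<in>{1..n}. real i / real n * (norm (z (\<pi> i)))\<^sup>2)"
  unfolding order_norm_def by (intro real_sqrt_pow2 sum_nonneg) auto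

definition optimal_cyclic_order ::
  "nat \<Rightarrow> (nat \<Rightarrow> real ^ 'd) \<Rightarrow> (nat \<Rightarrow> real ^ 'd) \<Rightarrow> (nat \<Rightarrow> nat) \<Rightarrow> bool" where
  "optimal_cyclic_order n z0 zs \<pi> \<longleftrightarrow>
     is_arg_min (\<lambda>\<sigma>. (order_norm n \<sigma> (\<lambda>i. z0 i - zs i))\<^sup>2) (\<lambda>\<sigma>. \<sigma> permutes {1..n}) \<pi>"

text \<open>
  The regularizer may take the value \<open>\<infinity>\<close> (indicator functions of convex sets);
  real-valued convex functions are included via \<open>ereal\<close>.
\<close>

definition proper_convex :: "(real ^ 'd \<Rightarrow> ereal) \<Rightarrow> bool" where
  "proper_convex r \<longleftrightarrow>
     (\<forall>x. r x \<noteq> -\<infinity>) \<and> (\<exists>x. r x \<noteq> \<infinity>) \<and> convex {(x, t :: real). r x \<le> ereal t}"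

definition composite_objective ::
  "nat \<Rightarrow> (nat \<Rightarrow> real ^ 'd \<Rightarrow> real) \<Rightarrow> (real ^ 'd \<Rightarrow> ereal) \<Rightarrow> real ^ 'd \<Rightarrow> ereal" where
  "composite_objective n f r x = ereal (1 / real n * (\<Sum>i\<in>{1..n}. f i x)) + r x"

end

theory Submission imports Defs begin

text \<open>
  Transporting the permutation to the weights turns the claim into
  \<open>(\<Sum>i. (\<tau> i - i) * a i) \<ge> 0\<close> for a permutation \<open>\<tau>\<close> and decreasing \<open>a\<close>. The coefficients
  \<open>\<tau> i - i\<close> sum to zero and have nonnegative partial sums, because \<open>k\<close> distinct positive integers
  sum to at least \<open>1 + \<dots> + k\<close>, so summation by parts gives the inequality.
\<close>

text \<open>Induction by adding a new maximum \<open>b\<close>: the old elements lie in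
  \<open>{1..<b}\<close>, so \<open>b\<close> is at least the new cardinality, which is the term
  that the left-hand sum gains.\<close>

lemma sum_Icc_card_le_sum:
  fixes A :: "nat set"
  assumes "finite A" "0 \<notin> A"
  shows "\<Sum>{1..card A} \<le> \<Sum>A"
  using assms
proof (induction A rule: finite_linorder_max_induct)
  case empty
  then show ?case by simp
next
  case (insert b A)
  have "A \<subseteq> {1..<b}"
    using insert.hyps(2) insert.prems by (auto simp: Suc_le_eq intro!: gr0I)
  then have "card A \<le> b - 1"
    using card_mono[of "{1..<b}" A] by simp
  moreover have "0 < b"
    using insert.prems by auto
  ultimately have "Suc (card A) \<le> b"
    by simp
  moreover have "b \<notin> A"
    using insert.hyps(2) by blast
  ultimately show ?case
    using insert.IH insert.prems insert.hyps(1) by simp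
qed

text \<open>Summation by parts as an induction. The term \<open>a n\<close> times the full sum is
  kept because intermediate sums need not vanish; since they are nonnegative, lowering the factor to
  \<open>a (Suc n)\<close> only decreases it. No sign of \<open>a\<close> is assumed.\<close>

lemma sum_mult_antimono_ge:
  fixes a c :: "nat \<Rightarrow> real"
  assumes "\<And>i. 1 \<le> i \<Longrightarrow> i < n \<Longrightarrow> a (i + 1) \<le> a i"
    and "\<And>k. k \<le> n \<Longrightarrow> 0 \<le> (\<Sum>i\<in>{1..k}. c i)"
  shows "a n * (\<Sum>i\<in>{1..n}. c i) \<le> (\<Sum>i\<in>{1..n}. c i * a i)"
  using assms
proof (induction n)
  case 0
  then show ?case by simp
next
  case (Suc n)
  have IH: "a n * (\<Sum>i\<in>{1..n}. c i) \<le> (\<Sum>i\<in>{1..n}. c i * a i)"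
    by (rule Suc.IH) (use Suc.prems in auto)
  have "a (Suc n) * (\<Sum>i\<in>{1..n}. c i) \<le> a n * (\<Sum>i\<in>{1..n}. c i)"
  \<comment> \<open>Monotonicity starts at index 1, so \<open>a 0\<close> and \<open>a 1\<close> are
    not comparable; there the empty sum makes both sides zero.\<close>
  proof (cases "n = 0")
    case False
    then show ?thesis
      using Suc.prems(1)[of n] Suc.prems(2)[of n] by (intro mult_right_mono) auto
  qed simp
  with IH show ?case
    by (simp add: algebra_simps)
qed

lemma sum_mult_permutes_ge:
  fixes a :: "nat \<Rightarrow> real"
  assumes \<sigma>: "\<sigma> permutes {1..n}"
    and a: "\<And>i. 1 \<le> i \<Longrightarrow> i < n \<Longrightarrow> a (i + 1) \<le> a i"
  shows "(\<Sum>i\<in>{1..n}. real i * a i) \<le> (\<Sum>i\<in>{1..n}. real i * a (\<sigma> i))"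
proof -
  define \<tau> where "\<tau> = inv \<sigma>"
  have \<tau>: "\<tau> permutes {1..n}"
    unfolding \<tau>_def by (rule permutes_inv[OF \<sigma>])
  have partial: "0 \<le> (\<Sum>i\<in>{1..k}. real (\<tau> i) - real i)" if "k \<le> n" for k
  proof -
    have inj: "inj_on \<tau> {1..k}"
      using permutes_inj[OF \<tau>] by (rule inj_on_subset) simp
    have "\<tau> ` {1..k} \<subseteq> {1..n}"
      using permutes_image[OF \<tau>] that by (metis atLeastatMost_subset_iff image_mono order_refl)
    then have "\<Sum>{1..card (\<tau> ` {1..k})} \<le> \<Sum>(\<tau> ` {1..k})"
      by (intro sum_Icc_card_le_sum) auto
    then have "(\<Sum>i\<in>{1..k}. i) \<le> (\<Sum>i\<in>{1..k}. \<tau> i)"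
      using inj by (simp add: card_image sum.reindex)
    then have "real (\<Sum>i\<in>{1..k}. i) \<le> real (\<Sum>i\<in>{1..k}. \<tau> i)"
      by (rule of_nat_mono)
    then show ?thesis
      by (simp add: sum_subtractf)
  qed
  \<comment> \<open>This makes the lower bound \<open>a n * 0\<close> of the summation by parts
    vanish.\<close>
  have total: "(\<Sum>i\<in>{1..n}. real (\<tau> i) - real i) = 0"
    using sum.permute[OF \<tau>, of real] by (simp add: sum_subtractf o_def)
  have "0 \<le> (\<Sum>i\<in>{1..n}. (real (\<tau> i) - real i) * a i)"
    using sum_mult_antimono_ge[of n a "\<lambda>i. real (\<tau> i) - real i"] a partial total by simp
  \<comment> \<open>Reindex by \<sigma>, using \<open>\<tau> (\<sigma> i) = i\<close>.\<close>
  moreover have "(\<Sum>i\<in>{1..n}. real (\<tau> i) * a i) = (\<Sum>i\<in>{1..n}. real i * a (\<sigma> i))"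
    using sum.permute[OF \<sigma>, of "\<lambda>i. real (\<tau> i) * a i"] permutes_inverses(2)[OF \<sigma>]
    by (simp add: \<tau>_def o_def)
  ultimately show ?thesis
    by (simp add: left_diff_distrib sum_subtractf)
qed

theorem proposition4:
  fixes n :: nat
    and f :: "nat \<Rightarrow> real ^ 'd \<Rightarrow> real"
    and grad_f :: "nat \<Rightarrow> real ^ 'd \<Rightarrow> real ^ 'd"
    and r :: "real ^ 'd \<Rightarrow> ereal"
    and \<alpha> :: real
    and x_star :: "real ^ 'd"
    and z0 z_star :: "nat \<Rightarrow> real ^ 'd"
    and \<pi>_star :: "nat \<Rightarrow> nat"
  assumes "1 \<le> n"
    and "\<And>i. i \<in> {1..n} \<Longrightarrow> convex_on UNIV (f i)"
    and "\<And>i x. i \<in> {1..n} \<Longrightarrow> GDERIV (f i) x :> grad_f i x"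
    and "proper_convex r"
    and "0 < \<alpha>"
    and "is_arg_min (composite_objective n f r) (\<lambda>x. True) x_star"
    and "\<And>i. i \<in> {1..n} \<Longrightarrow> z_star i = x_star - \<alpha> *\<^sub>R grad_f i x_star"
    and "\<pi>_star permutes {1..n}"
    and "\<And>i. 1 \<le> i \<Longrightarrow> i < n \<Longrightarrow>
           (norm (z0 (\<pi>_star i) - z_star (\<pi>_star i)))\<^sup>2
             \<ge> (norm (z0 (\<pi>_star (i + 1)) - z_star (\<pi>_star (i + 1))))\<^sup>2"
  shows "optimal_cyclic_order n z0 z_star \<pi>_star"
proof -
  define w where "w = (\<lambda>i. (norm (z0 i - z_star i))\<^sup>2)"
  have norm_eq: "(order_norm n \<sigma> (\<lambda>i. z0 i - z_star i))\<^sup>2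
      = (\<Sum>i\<in>{1..n}. real i * w (\<sigma> i)) / real n" for \<sigma>
    by (simp add: order_norm_power2 w_def sum_divide_distrib)
  have "(\<Sum>i\<in>{1..n}. real i * w (\<pi>_star i)) \<le> (\<Sum>i\<in>{1..n}. real i * w (\<sigma> i))"
    if \<sigma>: "\<sigma> permutes {1..n}" for \<sigma>
  proof -
    \<comment> \<open>Relative to the sorted sequence \<open>w (\<pi>_star i)\<close>, the order
      \<sigma> is this permutation: composing it with \<open>\<pi>_star\<close> gives back
      \<sigma>.\<close>
    have "inv \<pi>_star \<circ> \<sigma> permutes {1..n}"
      using \<sigma> permutes_inv[OF assms(8)] by (rule permutes_compose)
    from sum_mult_permutes_ge[OF this, of "\<lambda>i. w (\<pi>_star i)"] show ?thesis
      using assms(9) by (simp add: w_def permutes_inverses(1)[OF assms(8)])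
  qed
  then show ?thesis
    unfolding optimal_cyclic_order_def is_arg_min_linorder norm_eq
    using assms(8) by (auto intro: divide_right_mono)
qed

end
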